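(* Fix $\varepsilon>0$. There exists $n_0(\varepsilon)$ such that for all integers $n\ge n_0(\varepsilon)$ and $k$ with $3\le k\le\left(\frac{n}{1+\varepsilon}\right)^{1/2}$, $$ch(KG_{n,k})>\left(\frac14-\frac1{2k}-\varepsilon\right)\frac{n\log n}{2}.$$
   Context: The Kneser graph $KG_{n,k}$ has vertex set $\binom{[n]}{k}$ (the $k$-element subsets of $[n]=\{1,\dots,n\}$), two vertices being adjacent iff the sets are disjoint. The choice number $ch(G)$ of a graph $G$ is the smallest $\ell$ such that whenever each vertex is assigned a list of at least $\ell$ colors, one can choose a color from each vertex's list so that adjacent vertices receive different colors. *)

theory Defs
  imports Complex_Main
begin

text \<open>A graph is given by a vertex set \<open>V\<close> and an adjacency relation \<open>adj\<close>, of which only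
  the restriction to \<open>V\<close> matters. Colors are natural numbers, which is no restriction for
  finite graphs.\<close>

definition list_colorable :: "'v set \<Rightarrow> ('v \<Rightarrow> 'v \<Rightarrow> bool) \<Rightarrow> ('v \<Rightarrow> nat set) \<Rightarrow> bool" where
  "list_colorable V adj L \<longleftrightarrow>
     (\<exists>c. (\<forall>v\<in>V. c v \<in> L v) \<and> (\<forall>u\<in>V. \<forall>v\<in>V. adj u v \<longrightarrow> c u \<noteq> c v))"

definition choosable :: "'v set \<Rightarrow> ('v \<Rightarrow> 'v \<Rightarrow> bool) \<Rightarrow> nat \<Rightarrow> bool" where
  "choosable V adj l \<longleftrightarrow>
     (\<forall>L. (\<forall>v\<in>V. finite (L v) \<and> l \<le> card (L v)) \<longrightarrow> list_colorable V adj L)"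

definition choice_number :: "'v set \<Rightarrow> ('v \<Rightarrow> 'v \<Rightarrow> bool) \<Rightarrow> nat" where
  "choice_number V adj = (LEAST l. choosable V adj l)"

definition kneser_verts :: "nat \<Rightarrow> nat \<Rightarrow> nat set set" where
  "kneser_verts n k = {A. A \<subseteq> {1..n} \<and> card A = k}"

text \<open>Distinctness matters only for \<open>k = 0\<close>, where it excludes a loop at the empty set.\<close>

definition kneser_adj :: "nat set \<Rightarrow> nat set \<Rightarrow> bool" where
  "kneser_adj A B \<longleftrightarrow> A \<noteq> B \<and> A \<inter> B = {}"

text \<open>The minimum in \<open>choice_number\<close> is attained for every finite loopless graph, so the
  \<open>LEAST\<close> above is never unspecified on the graphs considered here.\<close>

lemma inj_choice:
  assumes "finite V" "\<And>v. v \<in> V \<Longrightarrow> finite (L v) \<and> card V \<le> card (L v)"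
  shows "\<exists>c::'v \<Rightarrow> nat. (\<forall>v\<in>V. c v \<in> L v) \<and> inj_on c V"
  using assms
proof (induction V rule: finite_induct)
  case empty
  then show ?case by simp
next
  case (insert x F)
  have "\<exists>c. (\<forall>v\<in>F. c v \<in> L v) \<and> inj_on c F"
    using insert.IH insert.prems insert.hyps by force
  then obtain c where c: "\<forall>v\<in>F. c v \<in> L v" "inj_on c F" by blast
  have "card (c ` F) < card (L x)"
    using insert.prems[of x] insert.hyps card_image_le[of F c] by simp
  then have "\<not> L x \<subseteq> c ` F"
    using insert.hyps card_mono[of "c ` F" "L x"] by auto
  then obtain y where y: "y \<in> L x" "y \<notin> c ` F" by blast
  have "inj_on (c(x := y)) (insert x F)"
    using c(2) y(2) insert.hyps(2) by (auto simp: inj_on_def)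
  moreover have "\<forall>v\<in>insert x F. (c(x := y)) v \<in> L v"
    using c(1) y(1) by auto
  ultimately show ?case by blast
qed

lemma choosable_card:
  assumes "finite V" "\<And>v. v \<in> V \<Longrightarrow> \<not> adj v v"
  shows "choosable V adj (card V)"
  unfolding choosable_def list_colorable_def
proof (intro allI impI)
  fix L :: "'a \<Rightarrow> nat set"
  assume "\<forall>v\<in>V. finite (L v) \<and> card V \<le> card (L v)"
  then obtain c where "\<forall>v\<in>V. c v \<in> L v" "inj_on c V"
    using inj_choice[OF assms(1), of L] by blast
  then show "\<exists>c. (\<forall>v\<in>V. c v \<in> L v) \<and> (\<forall>u\<in>V. \<forall>v\<in>V. adj u v \<longrightarrow> c u \<noteq> c v)"
    using assms(2) by (metis inj_onD)
qed

lemma choosable_choice_number: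
  assumes "finite V" "\<And>v. v \<in> V \<Longrightarrow> \<not> adj v v"
  shows "choosable V adj (choice_number V adj)"
  unfolding choice_number_def by (rule LeastI) (rule choosable_card[OF assms])

end

theory Submission
  imports Defs "HOL-Combinatorics.Permutations" "HOL-Library.FuncSet" "HOL-Real_Asymp.Real_Asymp"
begin

text \<open>Write \<open>v = n choose k\<close>. Averaging over the placements of \<open>n div k\<close> disjoint
  \<open>k\<close>-sets, a family noticeably larger than the star bound \<open>(k/n) v\<close> contains a set disjoint
  from a \<open>k/n\<close> proportion of \<open>v\<close> of its members. The graph container algorithm therefore covers
  all intersecting families by \<open>exp (O(n log n))\<close> containers of size at most \<open>6/5 (k/n) v\<close>.

  Now give each vertex a random \<open>l\<close>-subset of a palette of \<open>2 l\<close> colours. A proper colouring puts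
  each colour class into a container. Once a container is fixed for each colour, a tenth of the
  vertices lie in the containers of at most \<open>8/3 l k/n\<close> colours, and each of these misses all of
  them with probability at least \<open>exp (- 2 l k/n)\<close>, independently of the others. For \<open>l\<close> at most
  \<open>(1/4 - 1/(2k)) n log n / 2\<close> this leaves at least of the order of \<open>n powr (9/4)\<close> bad
  vertices on average, which beats the \<open>exp (O((n log n)\<^sup>2))\<close> choices of containers.\<close>

section \<open>Graph containers from high degrees inside large sets\<close>

definition independent_in :: "('v \<Rightarrow> 'v \<Rightarrow> bool) \<Rightarrow> 'v set \<Rightarrow> bool" where
  "independent_in adj F \<longleftrightarrow> (\<forall>u\<in>F. \<forall>v\<in>F. \<not> adj u v)"

text \<open>While the current set is larger than \<open>a\<close>, branch on a vertex
  \<open>v\<close> with \<open>h\<close> neighbours in it: an independent set either avoids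
  \<open>v\<close> or, if it contains \<open>v\<close>, avoids those neighbours. The second branch
  discards at least \<open>h + 1\<close> elements, so it occurs at most \<open>card A / h\<close>
  times along a path. This bounds the exponent of the count and the number of vertices added back to
  a final set of size at most \<open>a\<close>.\<close>

lemma exists_containers:
  fixes adj :: "'v \<Rightarrow> 'v \<Rightarrow> bool" and a :: real and h :: nat
  assumes fin: "finite A" and h: "0 < h" and a: "0 \<le> a"
    and dense: "\<And>B. B \<subseteq> A \<Longrightarrow> a < real (card B) \<Longrightarrow> \<exists>v\<in>B. h \<le> card {u\<in>B. u \<noteq> v \<and> adj v u}"
  shows "\<exists>\<C>. finite \<C> \<and> card \<C> \<le> (card A + 1) ^ (1 + card A div h) \<and>
           (\<forall>C\<in>\<C>. C \<subseteq> A \<and> real (card C) \<le> a + real (card A) / real h) \<and>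
           (\<forall>F\<subseteq>A. independent_in adj F \<longrightarrow> (\<exists>C\<in>\<C>. F \<subseteq> C))"
  using fin dense
proof (induction A rule: finite_psubset_induct)
  case (psubset A)
  show ?case
  proof (cases "real (card A) \<le> a")
    case True
    show ?thesis
    proof (intro exI conjI ballI allI impI)
      show "finite {A}" by simp
      show "card {A} \<le> (card A + 1) ^ (1 + card A div h)"
        by (rule ord_eq_le_trans[OF _ one_le_power]) auto
    qed (use True in \<open>auto intro: add_increasing2\<close>)
  next
    case False
    then obtain v where v: "v \<in> A" "h \<le> card {u\<in>A. u \<noteq> v \<and> adj v u}"
      using psubset.prems[of A] by auto
    define N where "N = {u\<in>A. u \<noteq> v \<and> adj v u}"
    define A1 where "A1 = A - {v}"
    define A2 where "A2 = A - {v} - N"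
    have fN: "finite N" "N \<subseteq> A - {v}" using psubset.hyps by (auto simp: N_def)
    have c1: "card A1 = card A - 1" and pos: "card A \<ge> 1"
      using v psubset.hyps by (auto simp: A1_def Suc_le_eq card_gt_0_iff)
    have c2: "card A2 = card A - 1 - card N"
      using fN v psubset.hyps by (simp add: A2_def card_Diff_subset)
    have Nle: "card N \<le> card A - 1" using card_mono[of "A - {v}" N] fN psubset.hyps v by simp
    have hN: "h \<le> card N" using v by (simp add: N_def)
    have c2': "card A2 + h + 1 \<le> card A" using c2 Nle hN pos by simp
    have "A1 \<subset> A" "A2 \<subset> A" using v by (auto simp: A1_def A2_def)
    have "\<exists>\<C>. finite \<C> \<and> card \<C> \<le> (card A1 + 1) ^ (1 + card A1 div h) \<and>
           (\<forall>C\<in>\<C>. C \<subseteq> A1 \<and> real (card C) \<le> a + real (card A1) / real h) \<and>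
           (\<forall>F\<subseteq>A1. independent_in adj F \<longrightarrow> (\<exists>C\<in>\<C>. F \<subseteq> C))"
      using psubset.prems \<open>A1 \<subset> A\<close> by (intro psubset.IH) auto
    then obtain C1 where C1: "finite C1" "card C1 \<le> (card A1 + 1) ^ (1 + card A1 div h)"
      "\<forall>C\<in>C1. C \<subseteq> A1 \<and> real (card C) \<le> a + real (card A1) / real h"
      "\<forall>F\<subseteq>A1. independent_in adj F \<longrightarrow> (\<exists>C\<in>C1. F \<subseteq> C)"
      by (elim exE conjE) (rule that)
    have "\<exists>\<C>. finite \<C> \<and> card \<C> \<le> (card A2 + 1) ^ (1 + card A2 div h) \<and>
           (\<forall>C\<in>\<C>. C \<subseteq> A2 \<and> real (card C) \<le> a + real (card A2) / real h) \<and>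
           (\<forall>F\<subseteq>A2. independent_in adj F \<longrightarrow> (\<exists>C\<in>\<C>. F \<subseteq> C))"
      using psubset.prems \<open>A2 \<subset> A\<close> by (intro psubset.IH) auto
    then obtain C2 where C2: "finite C2" "card C2 \<le> (card A2 + 1) ^ (1 + card A2 div h)"
      "\<forall>C\<in>C2. C \<subseteq> A2 \<and> real (card C) \<le> a + real (card A2) / real h"
      "\<forall>F\<subseteq>A2. independent_in adj F \<longrightarrow> (\<exists>C\<in>C2. F \<subseteq> C)"
      by (elim exE conjE) (rule that)
    let ?C = "C1 \<union> insert v ` C2"
    define s where "s = card A"
    define e where "e = s div h"
    have e1: "card A1 div h \<le> e" unfolding e_def s_def c1 by (intro div_le_mono) simp
    \<comment> \<open>Losing \<open>h\<close> elements lowers the quotient by one, so the second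
      branch contributes one power of \<open>s\<close> less than the first.\<close>
    have e2: "1 + card A2 div h \<le> e"
    proof -
      have "1 + card A2 div h = (card A2 + h) div h" using h by simp
      also have "\<dots> \<le> e" unfolding e_def s_def using c2' by (intro div_le_mono) simp
      finally show ?thesis .
    qed
    have "card ?C \<le> card C1 + card C2"
      by (rule order_trans[OF card_Un_le]) (simp add: card_image_le C2)
    also have "\<dots> \<le> s ^ (1 + e) + s ^ e"
    proof (rule add_mono)
      have "(card A1 + 1) ^ (1 + card A1 div h) = s ^ (1 + card A1 div h)"
        using c1 pos by (simp add: s_def)
      also have "\<dots> \<le> s ^ (1 + e)" using e1 pos by (intro power_increasing) (auto simp: s_def)
      finally show "card C1 \<le> s ^ (1 + e)" using C1(2) by simp
      have "(card A2 + 1) ^ (1 + card A2 div h) \<le> s ^ (1 + card A2 div h)"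
        using c2' by (intro power_mono) (auto simp: s_def)
      also have "\<dots> \<le> s ^ e" using e2 pos by (intro power_increasing) (auto simp: s_def)
      finally show "card C2 \<le> s ^ e" using C2(2) by simp
    qed
    also have "\<dots> = (s + 1) * s ^ e" by simp
    also have "\<dots> \<le> (s + 1) * (s + 1) ^ e" by (intro mult_left_mono power_mono) auto
    finally have cnt: "card ?C \<le> (card A + 1) ^ (1 + card A div h)" by (simp add: s_def e_def)
    have sz: "C \<subseteq> A \<and> real (card C) \<le> a + real (card A) / real h" if C: "C \<in> ?C" for C
      using C
    proof
      assume "C \<in> C1"
      then have "C \<subseteq> A1" "real (card C) \<le> a + real (card A1) / real h" using C1 by auto
      moreover have "real (card A1) / real h \<le> real (card A) / real h"
        using c1 by (intro divide_right_mono) auto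
      ultimately show ?thesis by (auto simp: A1_def)
    next
      assume "C \<in> insert v ` C2"
      then obtain C' where C': "C' \<in> C2" "C = insert v C'" by blast
      then have *: "C' \<subseteq> A2" "real (card C') \<le> a + real (card A2) / real h" using C2 by auto
      \<comment> \<open>The vertex put back costs \<open>1 = h / h\<close>, paid for by the elements
        missing from \<open>A2\<close>.\<close>
      have "real (card C) \<le> 1 + real (card C')"
        using * psubset.hyps unfolding C'(2)
        by (subst card_insert_if) (auto simp: A2_def intro: finite_subset)
      also have "\<dots> \<le> a + (real (card A2) + real h) / real h"
        using * h by (simp add: add_divide_distrib)
      also have "\<dots> \<le> a + real (card A) / real h"
        using c2' by (intro add_left_mono divide_right_mono) auto
      finally show ?thesis using * C'(2) v by (auto simp: A2_def)
    qed
    have cov: "\<exists>C\<in>?C. F \<subseteq> C" if F: "F \<subseteq> A" "independent_in adj F" for F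
    proof (cases "v \<in> F")
      case False
      then have "F \<subseteq> A1" using F by (auto simp: A1_def)
      then have "\<exists>C\<in>C1. F \<subseteq> C" using C1(4) F(2) by simp
      then show ?thesis by auto
    next
      case True
      have "F - {v} \<subseteq> A2" using F True by (auto simp: A2_def N_def independent_in_def)
      moreover have "independent_in adj (F - {v})" using F by (auto simp: independent_in_def)
      ultimately have "\<exists>C\<in>C2. F - {v} \<subseteq> C" using C2(4) by simp
      then obtain C where "C \<in> C2" "F - {v} \<subseteq> C" ..
      then have "insert v C \<in> ?C" "F \<subseteq> insert v C" by auto
      then show ?thesis by blast
    qed
    show ?thesis
      using C1(1) C2(1) cnt sz cov by (intro exI[of _ ?C] conjI ballI allI impI) auto
  qed
qed

section \<open>Averaging over permutations of the ground set\<close>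

text \<open>Each value of \<open>g\<close> is met once per element of a fibre, and all fibres have
  the same size, so the two means agree. The cross-multiplied form also covers an empty
  \<open>Q\<close>, which forces \<open>P\<close> to be empty.\<close>

lemma card_mult_sum_equal_fibres:
  fixes g :: "'b \<Rightarrow> real"
  assumes fin: "finite P" "finite Q" and maps: "\<And>p. p \<in> P \<Longrightarrow> \<phi> p \<in> Q"
    and fibres: "\<And>y y'. y \<in> Q \<Longrightarrow> y' \<in> Q \<Longrightarrow> card {p\<in>P. \<phi> p = y} = card {p\<in>P. \<phi> p = y'}"
  shows "real (card Q) * (\<Sum>p\<in>P. g (\<phi> p)) = real (card P) * (\<Sum>y\<in>Q. g y)"
proof (cases "Q = {}")
  case True
  then show ?thesis using maps by auto
next
  case False
  then obtain y0 where y0: "y0 \<in> Q" by blast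
  define c where "c = card {p\<in>P. \<phi> p = y0}"
  have c: "card {p\<in>P. \<phi> p = y} = c" if "y \<in> Q" for y using fibres[OF that y0] by (simp add: c_def)
  have sum: "(\<Sum>p\<in>P. f (\<phi> p)) = real c * (\<Sum>y\<in>Q. f y)" for f :: "'b \<Rightarrow> real"
  proof -
    have "(\<Sum>p\<in>P. f (\<phi> p)) = (\<Sum>y\<in>Q. \<Sum>p\<in>{p\<in>P. \<phi> p = y}. f (\<phi> p))"
      using maps by (intro sum.group[symmetric] fin) auto
    also have "\<dots> = (\<Sum>y\<in>Q. real c * f y)" using c by (intro sum.cong) auto
    finally show ?thesis by (simp add: sum_distrib_left)
  qed
  have "real (card P) = real c * real (card Q)" using sum[of "\<lambda>_. 1"] by simp
  then show ?thesis using sum[of g] by simp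
qed

text \<open>The permutation is glued from bijections on \<open>S\<close>, on \<open>T\<close> and on
  the rest of \<open>X\<close>; disjointness makes the two remainders equally large.\<close>

lemma exists_permutes_image_pair:
  assumes fin: "finite X"
    and S: "S \<subseteq> X" "T \<subseteq> X" "S \<inter> T = {}" and S': "S' \<subseteq> X" "T' \<subseteq> X" "S' \<inter> T' = {}"
    and card: "card S = card S'" "card T = card T'"
  shows "\<exists>\<tau>. \<tau> permutes X \<and> \<tau> ` S = S' \<and> \<tau> ` T = T'"
proof -
  have fins: "finite S" "finite T" "finite S'" "finite T'"
    using S S' fin by (auto intro: finite_subset)
  obtain f where f: "bij_betw f S S'" using finite_same_card_bij[OF fins(1,3) card(1)] by blast
  obtain g where g: "bij_betw g T T'" using finite_same_card_bij[OF fins(2,4) card(2)] by blast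
  have "card (X - (S \<union> T)) = card (X - (S' \<union> T'))"
    using S S' fins card by (simp add: card_Diff_subset card_Un_disjoint)
  then obtain q where q: "bij_betw q (X - (S \<union> T)) (X - (S' \<union> T'))"
    using finite_same_card_bij fin by blast
  define \<tau> where "\<tau> x = (if x \<in> S then f x else if x \<in> T then g x else if x \<in> X then q x else x)" for x
  have 1: "bij_betw \<tau> S S'" using f by (subst bij_betw_cong[of _ _ f]) (auto simp: \<tau>_def)
  have 2: "bij_betw \<tau> T T'" using g S by (subst bij_betw_cong[of _ _ g]) (auto simp: \<tau>_def)
  have 3: "bij_betw \<tau> (X - (S \<union> T)) (X - (S' \<union> T'))"
    using q S by (subst bij_betw_cong[of _ _ q]) (auto simp: \<tau>_def)
  have "bij_betw \<tau> ((S \<union> T) \<union> (X - (S \<union> T))) ((S' \<union> T') \<union> (X - (S' \<union> T')))"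
    by (intro bij_betw_combine 1 2 3) (use S' in auto)
  then have "bij_betw \<tau> X X" using S S' by (simp add: Un_absorb1)
  then have "\<tau> permutes X" using S by (intro bij_imp_permutes) (auto simp: \<tau>_def)
  then show ?thesis using 1 2 by (auto simp: bij_betw_def)
qed

text \<open>For finite \<open>X\<close>, taking \<open>l = 0\<close> gives single
  \<open>k\<close>-sets paired with \<open>{}\<close>, and \<open>l = k > 0\<close> gives ordered
  Kneser edges, so one notion serves first and second moments.\<close>

definition disjoint_pairs :: "'a set \<Rightarrow> nat \<Rightarrow> nat \<Rightarrow> ('a set \<times> 'a set) set" where
  "disjoint_pairs X k l = {(S, T). S \<subseteq> X \<and> T \<subseteq> X \<and> S \<inter> T = {} \<and> card S = k \<and> card T = l}"

lemma finite_disjoint_pairs: "finite X \<Longrightarrow> finite (disjoint_pairs X k l)"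
  by (rule finite_subset[of _ "Pow X \<times> Pow X"]) (auto simp: disjoint_pairs_def)

lemma card_disjoint_pairs:
  assumes "finite X"
  shows "card (disjoint_pairs X k l) = (card X choose k) * ((card X - k) choose l)"
proof -
  have "disjoint_pairs X k l =
      (SIGMA S : {S. S \<subseteq> X \<and> card S = k}. {T. T \<subseteq> X - S \<and> card T = l})"
    by (auto simp: disjoint_pairs_def)
  also have "card \<dots> = (\<Sum>S\<in>{S. S \<subseteq> X \<and> card S = k}. card {T. T \<subseteq> X - S \<and> card T = l})"
    using assms by (intro card_SigmaI) auto
  also have "\<dots> = (\<Sum>S\<in>{S. S \<subseteq> X \<and> card S = k}. (card X - k) choose l)"
    using assms by (intro sum.cong) (auto simp: n_subsets card_Diff_subset finite_subset)
  finally show ?thesis using assms by (simp add: n_subsets)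
qed

text \<open>A uniformly random permutation carries a fixed disjoint pair to a uniformly random one:
  by transitivity, composing with a suitable permutation moves any fibre into any other.\<close>

lemma sum_permutes_disjoint_pair:
  fixes g :: "'a set \<times> 'a set \<Rightarrow> real"
  assumes fin: "finite X" and B: "(B1, B2) \<in> disjoint_pairs X k l"
  shows "real (card (disjoint_pairs X k l)) * (\<Sum>\<sigma> | \<sigma> permutes X. g (\<sigma> ` B1, \<sigma> ` B2)) =
         fact (card X) * (\<Sum>y\<in>disjoint_pairs X k l. g y)"
proof -
  let ?P = "{\<sigma>. \<sigma> permutes X}"
  let ?\<phi> = "\<lambda>\<sigma>. (\<sigma> ` B1, \<sigma> ` B2)"
  have "real (card (disjoint_pairs X k l)) * (\<Sum>\<sigma>\<in>?P. g (?\<phi> \<sigma>)) =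
        real (card ?P) * (\<Sum>y\<in>disjoint_pairs X k l. g y)"
  proof (rule card_mult_sum_equal_fibres)
    fix \<sigma> assume "\<sigma> \<in> ?P"
    then have p: "\<sigma> permutes X" by simp
    note inj = permutes_inj[OF p]
    have "\<sigma> ` B1 \<subseteq> X" "\<sigma> ` B2 \<subseteq> X"
      using B permutes_in_image[OF p] by (auto simp: disjoint_pairs_def)
    moreover have "\<sigma> ` B1 \<inter> \<sigma> ` B2 = {}"
      using B inj by (auto simp: disjoint_pairs_def dest: injD)
    ultimately show "?\<phi> \<sigma> \<in> disjoint_pairs X k l"
      using B inj by (auto simp: disjoint_pairs_def card_image inj_on_subset)
  next
    fix y y' assume y: "y \<in> disjoint_pairs X k l" "y' \<in> disjoint_pairs X k l"
    have le: "card {p\<in>?P. ?\<phi> p = y} \<le> card {p\<in>?P. ?\<phi> p = y'}"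
      if y: "y \<in> disjoint_pairs X k l" "y' \<in> disjoint_pairs X k l" for y y'
    proof -
      obtain S T S' T' where eq: "y = (S, T)" "y' = (S', T')" by (cases y, cases y')
      obtain \<tau> where \<tau>: "\<tau> permutes X" "\<tau> ` S = S'" "\<tau> ` T = T'"
        using exists_permutes_image_pair[OF fin, of S T S' T'] y unfolding eq disjoint_pairs_def
        by auto
      have "inj_on ((\<circ>) \<tau>) {p\<in>?P. ?\<phi> p = y}"
        using fun.inj_map[OF permutes_inj[OF \<tau>(1)]] by (rule inj_on_subset) simp
      moreover have "(\<circ>) \<tau> ` {p\<in>?P. ?\<phi> p = y} \<subseteq> {p\<in>?P. ?\<phi> p = y'}"
      proof (intro image_subsetI CollectI conjI)
        fix \<sigma> assume "\<sigma> \<in> {p\<in>?P. ?\<phi> p = y}"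
        then have \<sigma>: "\<sigma> permutes X" "\<sigma> ` B1 = S" "\<sigma> ` B2 = T" by (auto simp: eq)
        show "\<tau> \<circ> \<sigma> permutes X" using \<sigma>(1) \<tau>(1) by (rule permutes_compose)
        show "?\<phi> (\<tau> \<circ> \<sigma>) = y'" unfolding image_comp[symmetric] using \<sigma> \<tau> by (simp add: eq)
      qed
      ultimately show ?thesis using fin by (intro card_inj_on_le) (auto simp: finite_permutations)
    qed
    show "card {p\<in>?P. ?\<phi> p = y} = card {p\<in>?P. ?\<phi> p = y'}"
      using le y by (intro antisym) auto
  qed (use fin in \<open>auto simp: finite_permutations finite_disjoint_pairs\<close>)
  moreover have "card ?P = fact (card X)" using fin by (simp add: card_permutations)
  ultimately show ?thesis by simp
qed

section \<open>Supersaturation of disjoint pairs in the Kneser graph\<close>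

lemma finite_kneser_verts: "finite (kneser_verts n k)"
  by (rule finite_subset[of _ "Pow {1..n}"]) (auto simp: kneser_verts_def)

lemma card_kneser_verts: "card (kneser_verts n k) = n choose k"
  using n_subsets[of "{1..n}" k] by (simp add: kneser_verts_def)

text \<open>If \<open>t\<close> indices satisfy \<open>Q\<close>, the left side is
  \<open>t * (t - 1)\<close>, and \<open>(t - 1) * (t - 2)\<close> is nonnegative for natural
  \<open>t\<close>. The linear bound lets a first moment control a count of pairs.\<close>

lemma sum_off_diagonal_of_bool_ge:
  assumes "finite I"
  shows "(\<Sum>i\<in>I. \<Sum>j\<in>I - {i}. of_bool (Q i \<and> Q j)) \<ge> 2 * (\<Sum>i\<in>I. of_bool (Q i)) - (2 :: real)"
proof -
  define t where "t = card {i\<in>I. Q i}"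
  have t: "(\<Sum>i\<in>I. of_bool (Q i)) = real t" using assms by (simp add: t_def of_bool_def sum.If_cases Int_def)
  have "(\<Sum>i\<in>I. \<Sum>j\<in>I - {i}. of_bool (Q i \<and> Q j)) = (\<Sum>i\<in>I. of_bool (Q i) * (real t - of_bool (Q i)))"
  proof (rule sum.cong)
    fix i assume i: "i \<in> I"
    have "(\<Sum>j\<in>I - {i}. of_bool (Q i \<and> Q j)) = of_bool (Q i) * (\<Sum>j\<in>I - {i}. of_bool (Q j) :: real)"
      by (simp add: of_bool_conj sum_distrib_left)
    also have "(\<Sum>j\<in>I - {i}. of_bool (Q j)) = real t - of_bool (Q i)"
      using sum.remove[OF assms i, of "\<lambda>j. of_bool (Q j) :: real"] t by linarith
    finally show "(\<Sum>j\<in>I - {i}. of_bool (Q i \<and> Q j)) = of_bool (Q i) * (real t - of_bool (Q i))" .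
  qed simp
  also have "\<dots> = (\<Sum>i\<in>I. of_bool (Q i) * (real t - 1))" by (intro sum.cong) auto
  also have "\<dots> = real t * (real t - 1)" by (simp add: sum_distrib_right[symmetric] t)
  also have "\<dots> \<ge> 2 * real t - 2"
  proof -
    consider "t = 0" | "t = 1" | "t \<ge> 2" by linarith
    then show ?thesis
    proof cases
      case 3
      then have "(real t - 1) * (real t - 2) \<ge> 0" by simp
      then show ?thesis by (simp add: algebra_simps)
    qed auto
  qed
  finally show ?thesis by (simp add: t)
qed

text \<open>Place \<open>r\<close> disjoint blocks of size \<open>k\<close> by a random permutation
  and let \<open>t\<close> of them land in \<open>A\<close>. The mean of \<open>t\<close> is
  \<open>r * card A / (n choose k)\<close>; the mean of \<open>t * (t - 1)\<close> is
  \<open>r * (r - 1)\<close> times the share of ordered disjoint pairs with both members in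
  \<open>A\<close>. The bound \<open>t * (t - 1) >= 2 * t - 2\<close> compares them.\<close>

lemma kneser_supersaturation:
  assumes A: "A \<subseteq> kneser_verts n k" and rk: "r * k \<le> n"
  shows "2 * (real r * real (card A) - real (n choose k)) * real ((n - k) choose k)
           \<le> real r * (real r - 1) * real (card {(S, T). S \<in> A \<and> T \<in> A \<and> S \<inter> T = {}})"
proof (cases "r = 0")
  case False
  define X where "X = {1..n}"
  have X: "finite X" "card X = n" by (auto simp: X_def)
  define B where "B j = {j * k + 1..(j + 1) * k}" for j
  have Bcard: "card (B j) = k" for j by (simp add: B_def)
  have Bsub: "B j \<subseteq> X" if "j < r" for j
  proof -
    have "(j + 1) * k \<le> r * k" using that by (intro mult_right_mono) auto
    then show ?thesis using rk by (auto simp: B_def X_def)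
  qed
  have Blt: "B i \<inter> B j = {}" if "i < j" for i j
  proof -
    have "(i + 1) * k \<le> j * k" using that by (intro mult_right_mono) auto
    then show ?thesis by (auto simp: B_def)
  qed
  then have Bdisj: "B i \<inter> B j = {}" if "i \<noteq> j" for i j using that by (metis Int_commute nat_neq_iff)
  let ?P = "{\<sigma>. \<sigma> permutes X}"
  let ?v = "real (n choose k)" and ?D = "real ((n - k) choose k)"
  define E where "E = {(S, T). S \<in> A \<and> T \<in> A \<and> S \<inter> T = {}}"
  have single: "?v * (\<Sum>\<sigma>\<in>?P. of_bool (\<sigma> ` B j \<in> A)) = fact n * real (card A)" if "j < r" for j
  proof -
    have "(B j, {}) \<in> disjoint_pairs X k 0" using Bsub that Bcard by (auto simp: disjoint_pairs_def)
    from sum_permutes_disjoint_pair[OF X(1) this, of "\<lambda>(S, T). of_bool (S \<in> A)"]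
    have "?v * (\<Sum>\<sigma>\<in>?P. of_bool (\<sigma> ` B j \<in> A)) =
          fact n * (\<Sum>(S, T)\<in>disjoint_pairs X k 0. of_bool (S \<in> A))"
      by (simp add: card_disjoint_pairs X)
    also have "disjoint_pairs X k 0 = kneser_verts n k \<times> {{}}"
      by (auto simp: disjoint_pairs_def kneser_verts_def X_def dest: finite_subset)
    also have "(\<Sum>(S, T)\<in>kneser_verts n k \<times> {{}}. of_bool (S \<in> A)) = real (card A)"
      using A finite_kneser_verts[of n k]
      by (simp add: sum.cartesian_product[symmetric] of_bool_def sum.If_cases Int_absorb1)
    finally show ?thesis .
  qed
  have pair: "?v * ?D * (\<Sum>\<sigma>\<in>?P. of_bool (\<sigma> ` B i \<in> A \<and> \<sigma> ` B j \<in> A)) = fact n * real (card E)"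
    if "i < r" "j < r" "i \<noteq> j" for i j
  proof -
    have "(B i, B j) \<in> disjoint_pairs X k k" using Bsub that Bcard Bdisj by (auto simp: disjoint_pairs_def)
    from sum_permutes_disjoint_pair[OF X(1) this, of "\<lambda>(S, T). of_bool (S \<in> A \<and> T \<in> A)"]
    have "?v * ?D * (\<Sum>\<sigma>\<in>?P. of_bool (\<sigma> ` B i \<in> A \<and> \<sigma> ` B j \<in> A)) =
          fact n * (\<Sum>(S, T)\<in>disjoint_pairs X k k. of_bool (S \<in> A \<and> T \<in> A))"
      by (simp add: card_disjoint_pairs X)
    also have "(\<Sum>(S, T)\<in>disjoint_pairs X k k. of_bool (S \<in> A \<and> T \<in> A)) =
               (\<Sum>p\<in>disjoint_pairs X k k. of_bool (p \<in> E) :: real)"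
      by (intro sum.cong) (auto simp: disjoint_pairs_def E_def)
    also have "\<dots> = real (card (disjoint_pairs X k k \<inter> E))"
      using finite_disjoint_pairs[OF X(1)] by (simp add: of_bool_def sum.If_cases)
    also have "disjoint_pairs X k k \<inter> E = E"
      using A by (auto simp: disjoint_pairs_def E_def kneser_verts_def X_def)
    finally show ?thesis .
  qed
  \<comment> \<open>The averages stay multiplied by \<open>?v * ?D\<close>, since \<open>?D\<close>
    may be zero; in the end only \<open>fact n\<close> is cancelled.\<close>
  have "2 * ?D * (fact n * (real r * real (card A) - ?v)) =
        ?v * ?D * (\<Sum>\<sigma>\<in>?P. 2 * (\<Sum>i<r. of_bool (\<sigma> ` B i \<in> A)) - 2)"
  proof -
    have "?v * (\<Sum>\<sigma>\<in>?P. \<Sum>i<r. of_bool (\<sigma> ` B i \<in> A)) = (\<Sum>i<r. ?v * (\<Sum>\<sigma>\<in>?P. of_bool (\<sigma> ` B i \<in> A)))"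
      by (subst sum.swap) (simp add: sum_distrib_left)
    also have "\<dots> = real r * (fact n * real (card A))" using single by simp
    finally have *: "?v * (\<Sum>\<sigma>\<in>?P. \<Sum>i<r. of_bool (\<sigma> ` B i \<in> A)) = real r * (fact n * real (card A))" .
    have "card ?P = fact n" using X by (simp add: card_permutations)
    then have eq: "?v * ?D * (\<Sum>\<sigma>\<in>?P. 2 * (\<Sum>i<r. of_bool (\<sigma> ` B i \<in> A)) - 2) =
          2 * ?D * (?v * (\<Sum>\<sigma>\<in>?P. \<Sum>i<r. of_bool (\<sigma> ` B i \<in> A)) - ?v * fact n)"
      by (simp add: sum_subtractf sum_distrib_left[symmetric] algebra_simps)
    show ?thesis unfolding eq * by (simp add: algebra_simps)
  qed
  also have "\<dots> \<le> ?v * ?D * (\<Sum>\<sigma>\<in>?P. \<Sum>i<r. \<Sum>j\<in>{..<r} - {i}. of_bool (\<sigma> ` B i \<in> A \<and> \<sigma> ` B j \<in> A))"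
    by (intro mult_left_mono sum_mono sum_off_diagonal_of_bool_ge) auto
  also have "\<dots> = (\<Sum>i<r. \<Sum>j\<in>{..<r} - {i}. ?v * ?D * (\<Sum>\<sigma>\<in>?P. of_bool (\<sigma> ` B i \<in> A \<and> \<sigma> ` B j \<in> A)))"
    unfolding sum_distrib_left[symmetric]
    by (rule arg_cong[where f = "(*) (?v * ?D)"], subst sum.swap, rule sum.cong[OF refl], rule sum.swap)
  also have "\<dots> = (\<Sum>i<r. \<Sum>j\<in>{..<r} - {i}. fact n * real (card E))"
    using pair by (intro sum.cong) auto
  also have "\<dots> = fact n * (real r * (real r - 1) * real (card E))"
    using False by (simp add: of_nat_diff)
  finally have "fact n * (2 * (real r * real (card A) - ?v) * ?D) \<le> fact n * (real r * (real r - 1) * real (card E))"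
    by (simp add: algebra_simps)
  then show ?thesis unfolding E_def by (simp add: mult_le_cancel_left)
qed simp

text \<open>The size of \<open>A\<close> makes the excess \<open>r * card A - (n choose k)\<close>
  at least \<open>r * card A / 11\<close>. Supersaturation with \<open>r * (r - 1) <= r * r\<close>
  then gives average degree at least the claimed bound, so some member attains it.\<close>

lemma kneser_dense_imp_degree:
  assumes A: "A \<subseteq> kneser_verts n k" and rk: "r * k \<le> n" and r: "0 < r" and k: "0 < k"
    and big: "11 / 10 * real (n choose k) / real r < real (card A)"
  shows "\<exists>S\<in>A. 2 * real ((n - k) choose k) / (11 * real r) \<le> real (card {T\<in>A. T \<noteq> S \<and> kneser_adj S T})"
proof (rule ccontr)
  define \<delta> where "\<delta> = 2 * real ((n - k) choose k) / (11 * real r)"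
  assume "\<not> ?thesis"
  then have deg: "real (card {T\<in>A. T \<noteq> S \<and> kneser_adj S T}) < \<delta>" if "S \<in> A" for S
    using that by (auto simp: \<delta>_def not_le)
  have finA: "finite A" using A finite_kneser_verts finite_subset by blast
  have "0 < real (card A)" using big by (rule le_less_trans[rotated]) simp
  then have ne: "A \<noteq> {}" by auto
  \<comment> \<open>As \<open>k > 0\<close>, no member is disjoint from itself, so there are no
    diagonal pairs.\<close>
  have "{(S, T). S \<in> A \<and> T \<in> A \<and> S \<inter> T = {}} = (SIGMA S : A. {T\<in>A. T \<noteq> S \<and> kneser_adj S T})"
    using A k by (auto simp: kneser_adj_def kneser_verts_def)
  then have "real (card {(S, T). S \<in> A \<and> T \<in> A \<and> S \<inter> T = {}}) =
             (\<Sum>S\<in>A. real (card {T\<in>A. T \<noteq> S \<and> kneser_adj S T}))"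
    using finA by (simp add: card_SigmaI)
  also have "\<dots> < (\<Sum>S\<in>A. \<delta>)" using deg ne finA by (intro sum_strict_mono) auto
  finally have E: "real (card {(S, T). S \<in> A \<and> T \<in> A \<and> S \<inter> T = {}}) < real (card A) * \<delta>" by simp
  let ?D = "real ((n - k) choose k)"
  have "real (n choose k) \<le> 10 / 11 * (real r * real (card A))" using big r by (simp add: field_simps)
  then have "2 * (real r * real (card A) / 11) * ?D \<le> 2 * (real r * real (card A) - real (n choose k)) * ?D"
    by (intro mult_right_mono) auto
  also have "\<dots> \<le> real r * (real r - 1) * real (card {(S, T). S \<in> A \<and> T \<in> A \<and> S \<inter> T = {}})"
    by (rule kneser_supersaturation[OF A rk])
  also have "\<dots> \<le> real r * real r * real (card {(S, T). S \<in> A \<and> T \<in> A \<and> S \<inter> T = {}})"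
    by (intro mult_right_mono mult_left_mono) auto
  also have "\<dots> < real r * real r * (real (card A) * \<delta>)" using E r by simp
  also have "\<dots> = 2 * (real r * real (card A) / 11) * ?D" using r by (simp add: \<delta>_def field_simps)
  finally show False by simp
qed

section \<open>Counting list assignments against containers\<close>

text \<open>The left side counts assignments of \<open>l\<close>-subsets of \<open>{..<N}\<close>.
  Each has a proper colouring whose class \<open>i\<close> lies in some container
  \<open>f i\<close>, so every list has a colour whose container holds the vertex. This is a union
  bound over \<open>f\<close>; for fixed \<open>f\<close> the lists are independent, whence the
  product.\<close>

lemma choosable_imp_sum_over_containers:
  assumes fin: "finite V" "finite \<C>" and ch: "choosable V adj l"
    and cov: "\<And>F. F \<subseteq> V \<Longrightarrow> independent_in adj F \<Longrightarrow> \<exists>C\<in>\<C>. F \<subseteq> C"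
  shows "real (N choose l) ^ card V \<le> (\<Sum>f\<in>{..<N} \<rightarrow>\<^sub>E \<C>. \<Prod>v\<in>V.
           real (N choose l) - real ((N - card {i. i < N \<and> v \<in> f i}) choose l))"
proof -
  define \<Lambda> where "\<Lambda> = V \<rightarrow>\<^sub>E {S. S \<subseteq> {..<N} \<and> card S = l}"
  define Hit where "Hit f v = {S. S \<subseteq> {..<N} \<and> card S = l \<and> (\<exists>i\<in>S. v \<in> f i)}" for f :: "nat \<Rightarrow> 'a set" and v
  have fin\<Lambda>: "finite {S. S \<subseteq> {..<N} \<and> card S = l}" by simp
  have cHit: "real (card (Hit f v)) = real (N choose l) - real ((N - card {i. i < N \<and> v \<in> f i}) choose l)" for f v
  proof -
    let ?Z = "{..<N} - {i. i < N \<and> v \<in> f i}"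
    have "Hit f v = {S. S \<subseteq> {..<N} \<and> card S = l} - {S. S \<subseteq> ?Z \<and> card S = l}"
      by (auto simp: Hit_def)
    moreover have "{S. S \<subseteq> ?Z \<and> card S = l} \<subseteq> {S. S \<subseteq> {..<N} \<and> card S = l}" by auto
    moreover have "card {S. S \<subseteq> ?Z \<and> card S = l} = (N - card {i. i < N \<and> v \<in> f i}) choose l"
    proof -
      have "card ?Z = N - card {i. i < N \<and> v \<in> f i}"
        by (subst card_Diff_subset) auto
      then show ?thesis by (simp add: n_subsets)
    qed
    moreover have "card {S. S \<subseteq> {..<N} \<and> card S = l} = N choose l" by (simp add: n_subsets)
    ultimately show ?thesis
      using card_Diff_subset[of "{S. S \<subseteq> ?Z \<and> card S = l}" "{S. S \<subseteq> {..<N} \<and> card S = l}"]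
        card_mono[OF fin\<Lambda>, of "{S. S \<subseteq> ?Z \<and> card S = l}"] by (simp add: of_nat_diff)
  qed
  have sub: "\<Lambda> \<subseteq> (\<Union>f\<in>{..<N} \<rightarrow>\<^sub>E \<C>. PiE V (Hit f))"
  proof
    fix L assume L: "L \<in> \<Lambda>"
    then have L': "L v \<subseteq> {..<N}" "card (L v) = l" if "v \<in> V" for v
      using that by (auto simp: \<Lambda>_def PiE_def Pi_def)
    then have "\<forall>v\<in>V. finite (L v) \<and> l \<le> card (L v)" by (auto intro: finite_subset[of _ "{..<N}"])
    then obtain c where c: "\<forall>v\<in>V. c v \<in> L v" "\<forall>u\<in>V. \<forall>v\<in>V. adj u v \<longrightarrow> c u \<noteq> c v"
      using ch unfolding choosable_def list_colorable_def by blast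
    have "\<exists>C\<in>\<C>. {v\<in>V. c v = i} \<subseteq> C" for i
    proof (rule cov)
      show "independent_in adj {v\<in>V. c v = i}"
        using c(2) unfolding independent_in_def by (metis (mono_tags, lifting) mem_Collect_eq)
    qed auto
    then obtain g where g: "\<And>i. g i \<in> \<C>" "\<And>i. {v\<in>V. c v = i} \<subseteq> g i" by metis
    \<comment> \<open>Only colours below \<open>N\<close> occur in lists; restricting makes
      \<open>f\<close> extensional, so that finitely many functions are counted.\<close>
    define f where "f = restrict g {..<N}"
    have f: "f \<in> {..<N} \<rightarrow>\<^sub>E \<C>" using g(1) by (auto simp: f_def)
    have "L v \<in> Hit f v" if v: "v \<in> V" for v
    proof -
      have "c v \<in> L v" using c(1) v by blast
      moreover have "c v < N" using calculation L'(1)[OF v] by auto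
      then have "v \<in> f (c v)" using g(2)[of "c v"] v by (auto simp: f_def)
      ultimately show ?thesis using L'[OF v] by (auto simp: Hit_def)
    qed
    then have "L \<in> PiE V (Hit f)" using L by (auto simp: \<Lambda>_def PiE_def)
    then show "L \<in> (\<Union>f\<in>{..<N} \<rightarrow>\<^sub>E \<C>. PiE V (Hit f))" using f by blast
  qed
  have finF: "finite ({..<N} \<rightarrow>\<^sub>E \<C>)" using fin by (intro finite_PiE) auto
  have finH: "finite (PiE V (Hit f))" for f
    using fin by (intro finite_PiE) (auto simp: Hit_def)
  have "(N choose l) ^ card V = card \<Lambda>"
    using fin by (simp add: \<Lambda>_def card_PiE n_subsets)
  also have "\<dots> \<le> card (\<Union>f\<in>{..<N} \<rightarrow>\<^sub>E \<C>. PiE V (Hit f))"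
    using sub finF finH by (intro card_mono) auto
  also have "\<dots> \<le> (\<Sum>f\<in>{..<N} \<rightarrow>\<^sub>E \<C>. card (PiE V (Hit f)))"
    using finF by (rule card_UN_le)
  finally have "real ((N choose l) ^ card V) \<le> real (\<Sum>f\<in>{..<N} \<rightarrow>\<^sub>E \<C>. card (PiE V (Hit f)))"
    by (simp only: of_nat_le_iff)
  also have "\<dots> = (\<Sum>f\<in>{..<N} \<rightarrow>\<^sub>E \<C>. \<Prod>v\<in>V. real (card (Hit f v)))"
    using fin by (simp add: card_PiE)
  finally show ?thesis by (simp add: cHit)
qed

text \<open>Lowering the upper index from \<open>M\<close> to \<open>M - 1\<close> multiplies the
  coefficient by \<open>1 - l / M\<close>. Within \<open>l / 13\<close> steps
  \<open>M >= 25/13 * l\<close>, so each factor is at least \<open>12/25\<close>.\<close>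

lemma central_binomial_decrease:
  assumes "13 * d \<le> l"
  shows "(12/25) ^ d * real ((2 * l) choose l) \<le> real ((2 * l - d) choose l)"
  using assms
proof (induction d)
  case (Suc d)
  define M where "M = 2 * l - d"
  have M: "d \<le> 2 * l" "l \<le> M" "0 < M" "2 * l - Suc d = M - 1" using Suc.prems by (auto simp: M_def)
  have "real ((M - l) * (M choose l)) = real (M * ((M - 1) choose l))"
    by (simp only: binomial_absorb_comp)
  then have eq: "real (M - l) * real (M choose l) = real M * real ((M - 1) choose l)" by simp
  have "12 * real M \<le> 25 * real (M - l)"
    using Suc.prems by (simp add: M_def of_nat_diff)
  then have "(12/25) * real M * real (M choose l) \<le> real (M - l) * real (M choose l)"
    by (intro mult_right_mono) auto
  then have "real M * ((12/25) * real (M choose l)) \<le> real M * real ((M - 1) choose l)"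
    by (simp add: eq)
  then have "(12/25) * real (M choose l) \<le> real ((M - 1) choose l)" using M by simp
  moreover have "(12/25) ^ d * real ((2 * l) choose l) \<le> real (M choose l)"
    using Suc by (simp add: M_def)
  ultimately show ?case using M(4) by simp
qed simp

text \<open>This amounts to \<open>ln (25/12) <= 3/4\<close>, obtained by squaring the quadratic
  Taylor bound for \<open>exp (3/8)\<close>.\<close>

lemma powr_12_25_ge_exp:
  assumes "0 \<le> d" shows "exp (- (3/4) * d) \<le> (12/25 :: real) powr d"
proof -
  have "(25/12 :: real) \<le> (1 + 3/8 + (3/8)\<^sup>2 / 2)\<^sup>2" by (simp add: power2_eq_square)
  also have "\<dots> \<le> exp (3/8) ^ 2"
    by (intro power_mono exp_lower_Taylor_quadratic) auto
  also have "\<dots> = exp (3/4)" by (simp add: exp_double[symmetric])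
  finally have "ln (25/12) \<le> ln (exp (3/4 :: real))" by (subst ln_le_cancel_iff) auto
  then have "- (3/4) \<le> ln (12/25 :: real)" using ln_inverse[of "25/12 :: real"] by simp
  then have "d * - (3/4) \<le> d * ln (12/25 :: real)" using assms by (rule mult_left_mono)
  then show ?thesis by (simp add: powr_def mult_ac)
qed

text \<open>Counting incidences of vertices with the \<open>2 * l\<close> chosen containers shows
  that a tenth of the vertices lie in at most \<open>d0\<close> of them. Each such list misses the
  relevant colours with probability at least \<open>(12/25) powr d0\<close>, which bounds the share
  of assignments compatible with one \<open>f\<close>; there are \<open>card \<C> ^ (2 * l)\<close>
  functions \<open>f\<close>.\<close>

lemma choosable_imp_many_containers:
  fixes V :: "'v set" and d0 s :: real
  assumes fin: "finite V" "finite \<C>" and ch: "choosable V adj l"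
    and cov: "\<And>F. F \<subseteq> V \<Longrightarrow> independent_in adj F \<Longrightarrow> \<exists>C\<in>\<C>. F \<subseteq> C"
    and size: "\<And>C. C \<in> \<C> \<Longrightarrow> C \<subseteq> V \<and> real (card C) \<le> s"
    and d0: "0 < d0" "13 * d0 \<le> real l" and s: "2 * real l * s \<le> 9/10 * d0 * real (card V)"
  shows "1 \<le> real (card \<C>) ^ (2 * l) * exp (- (real (card V) / 10) * (12/25) powr d0)"
proof -
  define T where "T = real ((2 * l) choose l)"
  have T: "0 < T" by (simp add: T_def)
  define q where "q = (12/25 :: real) powr d0"
  have q: "0 \<le> q" by (simp add: q_def)
  define d where "d f v = card {i. i < 2 * l \<and> v \<in> f i}" for f :: "nat \<Rightarrow> 'v set" and v
  \<comment> \<open>The probability that a random \<open>l\<close>-subset of the palette avoids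
    every colour whose container holds \<open>v\<close>.\<close>
  define p where "p f v = real ((2 * l - d f v) choose l) / T" for f v
  have prod: "(\<Prod>v\<in>V. T - real ((2 * l - d f v) choose l)) \<le> T ^ card V * exp (- (real (card V) / 10) * q)"
    if f: "f \<in> {..<2 * l} \<rightarrow>\<^sub>E \<C>" for f
  proof -
    define G where "G = {v\<in>V. real (d f v) \<le> d0}"
    have "(\<Sum>v\<in>V. real (d f v)) = (\<Sum>v\<in>V. \<Sum>i<2*l. of_bool (v \<in> f i))"
      by (intro sum.cong) (auto simp: d_def of_bool_def sum.If_cases Int_def)
    also have "\<dots> = (\<Sum>i<2*l. \<Sum>v\<in>V. of_bool (v \<in> f i))" by (rule sum.swap)
    also have "\<dots> \<le> (\<Sum>i<2*l. s)"
    proof (rule sum_mono)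
      fix i assume "i \<in> {..<2*l}"
      then have "f i \<in> \<C>" using f by auto
      then show "(\<Sum>v\<in>V. of_bool (v \<in> f i)) \<le> s"
        using size[of "f i"] fin by (simp add: of_bool_def sum.If_cases Int_absorb1 Int_commute)
    qed
    also have "\<dots> \<le> 9/10 * d0 * real (card V)" using s by simp
    finally have up: "(\<Sum>v\<in>V. real (d f v)) \<le> 9/10 * d0 * real (card V)" .
    \<comment> \<open>Markov's inequality: each vertex outside \<open>G\<close> contributes more
      than \<open>d0\<close> incidences.\<close>
    have "real (card (V - G)) * d0 = (\<Sum>v\<in>V - G. d0)" by simp
    also have "\<dots> \<le> (\<Sum>v\<in>V - G. real (d f v))" by (intro sum_mono) (auto simp: G_def)
    also have "\<dots> \<le> (\<Sum>v\<in>V. real (d f v))" using fin by (intro sum_mono2) auto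
    finally have "real (card (V - G)) * d0 \<le> (9/10 * real (card V)) * d0" using up by (simp add: mult_ac)
    then have "real (card (V - G)) \<le> 9/10 * real (card V)" using d0(1) by simp
    moreover have "card (V - G) = card V - card G" "card G \<le> card V"
      using fin by (auto simp: G_def card_Diff_subset intro: card_mono)
    ultimately have G: "real (card V) / 10 \<le> real (card G)" by (simp add: of_nat_diff)
    have pG: "q \<le> p f v" if "v \<in> G" for v
    proof -
      have dv: "real (d f v) \<le> d0" using that by (simp add: G_def)
      then have "real (13 * d f v) \<le> real l" using d0 by simp
      then have "13 * d f v \<le> l" by (simp only: of_nat_le_iff)
      from central_binomial_decrease[OF this] have "(12/25) ^ d f v \<le> p f v"
        using T by (simp add: p_def T_def field_simps)
      moreover have "q \<le> (12/25) powr real (d f v)"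
        unfolding q_def using dv by (intro powr_mono') auto
      ultimately show ?thesis by (simp add: powr_realpow)
    qed
    have "T - real ((2 * l - d f v) choose l) = T * (1 - p f v)" for v
      using T by (simp add: p_def field_simps)
    then have "(\<Prod>v\<in>V. T - real ((2 * l - d f v) choose l)) = T ^ card V * (\<Prod>v\<in>V. 1 - p f v)"
      by (simp add: prod.distrib)
    also have "\<dots> \<le> T ^ card V * (\<Prod>v\<in>V. exp (- p f v))"
    proof (intro mult_left_mono prod_mono conjI)
      fix v
      have "(2 * l - d f v) choose l \<le> (2 * l) choose l" by (rule binomial_right_mono) simp
      then show "0 \<le> 1 - p f v" using T by (simp add: p_def T_def)
      show "1 - p f v \<le> exp (- p f v)" using exp_ge_add_one_self[of "- p f v"] by simp
    qed (use T in auto)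
    also have "(\<Prod>v\<in>V. exp (- p f v)) = exp (- (\<Sum>v\<in>V. p f v))"
      using fin by (simp add: exp_sum sum_negf[symmetric])
    also have "T ^ card V * \<dots> \<le> T ^ card V * exp (- (real (card V) / 10) * q)"
    proof -
      have "real (card V) / 10 * q \<le> real (card G) * q" using G q by (rule mult_right_mono)
      also have "\<dots> = (\<Sum>v\<in>G. q)" by simp
      also have "\<dots> \<le> (\<Sum>v\<in>G. p f v)" using pG by (rule sum_mono)
      also have "\<dots> \<le> (\<Sum>v\<in>V. p f v)"
        using fin T by (intro sum_mono2) (auto simp: G_def p_def)
      finally show ?thesis using T by simp
    qed
    finally show ?thesis .
  qed
  have "T ^ card V \<le> (\<Sum>f\<in>{..<2*l} \<rightarrow>\<^sub>E \<C>. \<Prod>v\<in>V. T - real ((2 * l - d f v) choose l))"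
    using choosable_imp_sum_over_containers[OF fin ch cov, of "2 * l"] by (simp add: T_def d_def)
  also have "\<dots> \<le> (\<Sum>f\<in>{..<2*l} \<rightarrow>\<^sub>E \<C>. T ^ card V * exp (- (real (card V) / 10) * q))"
    by (rule sum_mono) (rule prod)
  also have "\<dots> = T ^ card V * (real (card \<C>) ^ (2 * l) * exp (- (real (card V) / 10) * q))"
    by (simp add: card_PiE)
  finally show ?thesis using T by (simp add: q_def)
qed

section \<open>Binomial estimates for \<open>k ^ 2 <= n\<close>\<close>

text \<open>Each of the \<open>k\<close> steps from \<open>n\<close> to \<open>n - k\<close> costs a
  factor \<open>(M - k) / M >= 1 - 2 * k / n\<close>, as \<open>M >= n / 2\<close>. The total is at
  least \<open>exp (- 4 * k^2 / n) >= exp (- 4) >= 1/81\<close>, the last from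
  \<open>exp 1 <= 3\<close>.\<close>

lemma binomial_shift_ge:
  assumes "16 \<le> n" "k ^ 2 \<le> n"
  shows "real (n choose k) / 81 \<le> real ((n - k) choose k)"
proof -
  have k4: "4 * k \<le> n"
  proof (cases "4 \<le> k")
    case True
    then have "4 * k \<le> k ^ 2" by (simp add: power2_eq_square)
    then show ?thesis using assms by linarith
  qed (use assms in auto)
  define x where "x = 2 * real k / real n"
  have x: "0 \<le> x" "x \<le> 1/2" using k4 assms by (auto simp: x_def field_simps)
  have step: "(1 - x) ^ d * real (n choose k) \<le> real ((n - d) choose k)" if "d \<le> k" for d
    using that
  proof (induction d)
    case (Suc d)
    define M where "M = n - d"
    have M: "k \<le> M" "0 < M" "n - Suc d = M - 1" "n \<le> 2 * M" using Suc.prems k4 assms by (auto simp: M_def)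
    have "real ((M - k) * (M choose k)) = real (M * ((M - 1) choose k))"
      by (simp only: binomial_absorb_comp)
    then have eq: "real (M - k) * real (M choose k) = real M * real ((M - 1) choose k)" by simp
    have "real n * real k \<le> 2 * real M * real k"
      using M(4) by (intro mult_right_mono) linarith+
    then have "(1 - x) * real M \<le> real (M - k)"
      using M assms by (simp add: x_def of_nat_diff field_simps)
    then have "(1 - x) * real M * real (M choose k) \<le> real (M - k) * real (M choose k)"
      by (intro mult_right_mono) auto
    then have "real M * ((1 - x) * real (M choose k)) \<le> real M * real ((M - 1) choose k)"
      unfolding eq by (simp only: mult_ac)
    then have "(1 - x) * real (M choose k) \<le> real ((M - 1) choose k)" using M by simp
    moreover have "(1 - x) * ((1 - x) ^ d * real (n choose k)) \<le> (1 - x) * real (M choose k)"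
      using Suc x by (intro mult_left_mono) (auto simp: M_def)
    ultimately show ?case using M(3) by simp
  qed simp
  have "exp (- 4) \<le> exp (- (2 * x * real k))"
  proof -
    have "real k ^ 2 \<le> real n" using assms(2) by (metis of_nat_le_iff of_nat_power)
    then show ?thesis using assms by (simp add: x_def power2_eq_square field_simps)
  qed
  also have "\<dots> = exp (- 2 * x) ^ k" by (simp add: exp_of_nat_mult[symmetric] mult_ac)
  also have "\<dots> \<le> (1 - x) ^ k"
  proof (rule power_mono)
    have "x * x \<le> x * (1/2)" using x by (intro mult_left_mono) auto
    then have "- 2 * x \<le> - x - 2 * x\<^sup>2" by (simp add: power2_eq_square)
    also have "\<dots> \<le> ln (1 - x)" using x by (rule ln_one_minus_pos_lower_bound)
    finally show "exp (- 2 * x) \<le> 1 - x" using x by (subst ln_ge_iff[symmetric]) auto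
  qed simp
  finally have "exp (- 4) \<le> (1 - x) ^ k" .
  moreover have "1 / 81 \<le> exp (- 4 :: real)"
  proof -
    have "exp 1 ^ 4 \<le> (3 :: real) ^ 4" using exp_le by (intro power_mono) auto
    then show ?thesis by (simp add: exp_of_nat_mult[symmetric] exp_minus field_simps)
  qed
  ultimately have "1 / 81 * real (n choose k) \<le> (1 - x) ^ k * real (n choose k)"
    by (intro mult_right_mono) auto
  then show ?thesis using step[of k] by simp
qed

text \<open>The factor \<open>n powr (1/2 - k/4)\<close> will bound the miss probability of a list
  from below. With \<open>(n/k) ^ k\<close> for the binomial, \<open>k <= 6\<close> gives exponent
  \<open>3/4 * k + 1/2\<close> and a loss of at most \<open>6 ^ 6\<close>. For
  \<open>k >= 7\<close>, \<open>n/k >= sqrt n\<close> gives exponent \<open>k/4 + 1/2\<close>, which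
  equals \<open>9/4\<close> at \<open>k = 7\<close>.\<close>

lemma binomial_powr_lower:
  assumes k: "3 \<le> k" "k ^ 2 \<le> n"
  shows "real n powr (9/4) / 6 ^ 6 \<le> real (n choose k) * real n powr (1/2 - real k / 4)"
proof -
  have kk: "k \<le> k ^ 2" by (simp add: power2_eq_square)
  then have kn: "k \<le> n" using k by linarith
  have n: "1 \<le> real n" using kn k by linarith
  have lower: "(real n / real k) ^ k \<le> real (n choose k)"
    by (rule binomial_ge_n_over_k_pow_k[OF kn])
  have main: "real n powr (9/4) / 6 ^ 6 \<le> (real n / real k) ^ k * real n powr (1/2 - real k / 4)"
  proof (cases "k \<le> 6")
    case True
    have "real k ^ k \<le> 6 ^ k" using True by (intro power_mono) auto
    also have "\<dots> \<le> 6 ^ 6" using True by (intro power_increasing) auto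
    finally have k6: "real k ^ k \<le> 6 ^ 6" .
    have "real n powr (9/4) \<le> real n powr (real k + (1/2 - real k / 4))"
      using n k by (intro powr_mono) (auto simp: field_simps)
    also have "\<dots> = real n ^ k * real n powr (1/2 - real k / 4)"
      using n by (subst powr_add) (simp add: powr_realpow)
    finally have "real n powr (9/4) / 6 ^ 6 \<le> real n ^ k * real n powr (1/2 - real k / 4) / real k ^ k"
      using k6 k by (intro frac_le) auto
    then show ?thesis by (simp add: power_divide)
  next
    case False
    have "real k ^ 2 \<le> real n" using k(2) by (metis of_nat_le_iff of_nat_power)
    then have "real k \<le> sqrt (real n)" by (intro real_le_rsqrt)
    then have "real k * sqrt (real n) \<le> sqrt (real n) * sqrt (real n)" by (intro mult_right_mono) auto
    then have "sqrt (real n) \<le> real n / real k" using k by (simp add: field_simps)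
    then have "sqrt (real n) ^ k \<le> (real n / real k) ^ k" by (intro power_mono) auto
    moreover have "sqrt (real n) ^ k = real n powr (real k / 2)"
      using n by (simp add: powr_half_sqrt[symmetric] powr_powr powr_realpow[symmetric])
    ultimately have *: "real n powr (real k / 2) \<le> (real n / real k) ^ k" by simp
    have "real n powr (9/4) / 6 ^ 6 \<le> real n powr (9/4)" by (simp add: divide_le_eq)
    also have "\<dots> \<le> real n powr (real k / 2 + (1/2 - real k / 4))"
      using n False by (intro powr_mono) (auto simp: field_simps)
    also have "\<dots> = real n powr (real k / 2) * real n powr (1/2 - real k / 4)" by (rule powr_add)
    also have "\<dots> \<le> (real n / real k) ^ k * real n powr (1/2 - real k / 4)"
      using * by (rule mult_right_mono) simp
    finally show ?thesis .
  qed
  also have "\<dots> \<le> real (n choose k) * real n powr (1/2 - real k / 4)"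
    using lower by (rule mult_right_mono) simp
  finally show ?thesis .
qed

section \<open>Containers for intersecting families and the final bound\<close>

text \<open>Dense families have a degree \<open>h\<close> of order \<open>v * k / n\<close>. Hence
  the size excess \<open>v / h\<close> is \<open>O(n/k)\<close>, negligible against
  \<open>v * k / n\<close>, and the count has base at most \<open>n ^ (k + 1)\<close> and exponent
  \<open>O(n/k)\<close>, so its logarithm is \<open>O(n log n)\<close>.\<close>

lemma kneser_exists_containers:
  assumes k: "3 \<le> k" "k ^ 2 \<le> n" and n: "100000000 \<le> n"
  shows "\<exists>\<C>. finite \<C> \<and> ln (real (card \<C>)) \<le> 896 * real n * ln (real n) \<and> 
           (\<forall>C\<in>\<C>. C \<subseteq> kneser_verts n k \<and>
              real (card C) \<le> 6/5 * (real k / real n) * real (n choose k)) \<and>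
           (\<forall>F\<subseteq>kneser_verts n k. independent_in kneser_adj F \<longrightarrow> (\<exists>C\<in>\<C>. F \<subseteq> C))"
proof -
  define v where "v = real (n choose k)"
  define r where "r = n div k"
  define y where "y = real n / real k"
  define D where "D = real ((n - k) choose k)"
  have k2: "real k ^ 2 \<le> real n" using k(2) by (metis of_nat_le_iff of_nat_power)
  have y: "10000 \<le> y"
  proof -
    have "10000 ^ 2 \<le> real n" using n by simp
    then have "10000 \<le> sqrt (real n)" by (rule real_le_rsqrt)
    moreover have "real k \<le> sqrt (real n)" using k2 by (rule real_le_rsqrt)
    ultimately have "10000 * real k \<le> sqrt (real n) * sqrt (real n)" by (intro mult_mono) auto
    then show ?thesis using k by (simp add: y_def field_simps)
  qed
  have kn: "k \<le> n" using y k by (simp add: y_def field_simps)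
  have rk: "r * k \<le> n" by (simp add: r_def)
  have r_le: "real r \<le> y" unfolding r_def y_def by (rule of_nat_div_le_of_nat) 
  have r_ge: "y - 1 \<le> real r"
  proof -
    have "n \<le> (r + 1) * k"
      using div_mult_mod_eq[of n k] mod_less_divisor[of k n] k
      unfolding r_def add_mult_distrib by linarith
    then have "real n \<le> (real r + 1) * real k" by (metis of_nat_le_iff of_nat_mult of_nat_add of_nat_1)
    then show ?thesis using k by (simp add: y_def field_simps)
  qed
  have r0: "0 < r" using r_ge y by (intro gr0I) auto
  have v0: "0 < v" using kn by (simp add: v_def)
  have v_ge: "y ^ 3 \<le> v"
  proof -
    have "y ^ 3 \<le> y ^ k" using y k by (intro power_increasing) auto
    also have "\<dots> \<le> v" unfolding y_def v_def by (rule binomial_ge_n_over_k_pow_k[OF kn])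
    finally show ?thesis .
  qed
  have D: "v / 81 \<le> D" unfolding v_def D_def using n k(2) by (intro binomial_shift_ge) auto
  define \<delta> where "\<delta> = 2 * D / (11 * real r)"
  have "2 * (v / 81) / (11 * real r) \<le> \<delta>"
    unfolding \<delta>_def using D r0 by (intro divide_right_mono mult_left_mono) auto
  then have \<delta>: "2 * v / (891 * real r) \<le> \<delta>" by simp
  have \<delta>0: "0 < \<delta>" using \<delta> v0 r0 by (intro less_le_trans[OF _ \<delta>]) simp
  define h where "h = nat \<lceil>\<delta>\<rceil>"
  have h: "\<delta> \<le> real h" "0 < h" using \<delta>0 unfolding h_def by linarith+
  have h_le: "h \<le> m" if "\<delta> \<le> real m" for m
    using that unfolding h_def by (simp add: ceiling_le_iff nat_le_iff)
  \<comment> \<open>The constant is \<open>81 * 11 / 2\<close>: the loss \<open>1/81\<close> of the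
    shifted binomial and the \<open>2/11\<close> of the degree bound.\<close>
  have vh: "v / real h \<le> 891 / 2 * real r"
  proof -
    have "2 * v / (891 * real r) \<le> real h" using \<delta> h by linarith
    then show ?thesis using h r0 by (simp add: field_simps)
  qed
  have dense: "\<exists>S\<in>B. h \<le> card {T\<in>B. T \<noteq> S \<and> kneser_adj S T}"
    if B: "B \<subseteq> kneser_verts n k" "11 / 10 * v / real r < real (card B)" for B
  proof -
    have "\<exists>S\<in>B. \<delta> \<le> real (card {T\<in>B. T \<noteq> S \<and> kneser_adj S T})"
      unfolding \<delta>_def D_def
      by (rule kneser_dense_imp_degree[OF B(1) rk r0]) (use B(2) k in \<open>auto simp: v_def\<close>)
    then show ?thesis using h_le by blast
  qed
  have a0: "0 \<le> 11 / 10 * v / real r" using v0 by simp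
  have "\<exists>\<C>. finite \<C> \<and>
      card \<C> \<le> (card (kneser_verts n k) + 1) ^ (1 + card (kneser_verts n k) div h) \<and>
      (\<forall>C\<in>\<C>. C \<subseteq> kneser_verts n k \<and>
         real (card C) \<le> 11 / 10 * v / real r + real (card (kneser_verts n k)) / real h) \<and>
      (\<forall>F\<subseteq>kneser_verts n k. independent_in kneser_adj F \<longrightarrow> (\<exists>C\<in>\<C>. F \<subseteq> C))"
    by (rule exists_containers[OF finite_kneser_verts h(2) a0]) (rule dense)
  then obtain \<C> where \<C>: "finite \<C>"
      "card \<C> \<le> (card (kneser_verts n k) + 1) ^ (1 + card (kneser_verts n k) div h)"
      "\<forall>C\<in>\<C>. C \<subseteq> kneser_verts n k \<and>
         real (card C) \<le> 11 / 10 * v / real r + real (card (kneser_verts n k)) / real h"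
      "\<forall>F\<subseteq>kneser_verts n k. independent_in kneser_adj F \<longrightarrow> (\<exists>C\<in>\<C>. F \<subseteq> C)"
    by (elim exE conjE) (rule that)
  \<comment> \<open>Here \<open>6/5 = 23/20 + 1/20\<close>: replacing \<open>r\<close> by
    \<open>22/23 * y\<close> turns \<open>11/10\<close> into \<open>23/20\<close>, and
    \<open>8920 * y^2 <= y^3 <= v\<close> makes \<open>v / h\<close> fit into the rest.\<close>
  have size: "11 / 10 * v / real r + v / real h \<le> 6/5 * (real k / real n) * v"
  proof -
    have "22/23 * y \<le> real r" using r_ge y by linarith
    then have "11 / 10 * v / real r \<le> 11 / 10 * v / (22/23 * y)"
      using v0 y by (intro divide_left_mono mult_pos_pos) auto
    moreover have "v / real h \<le> v / (20 * y)"
    proof -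
      have "446 * y * (20 * y) \<le> y * (y * y)"
        using y mult_right_mono[of 8920 y "y * y"] by simp
      also have "\<dots> \<le> v" using v_ge by (simp add: power3_eq_cube)
      finally have "446 * y \<le> v / (20 * y)" using y by (simp add: pos_le_divide_eq)
      then show ?thesis using vh r_le y by linarith
    qed
    moreover have "11 / 10 * v / (22/23 * y) + v / (20 * y) = 6/5 * (1 / y) * v"
      using y by (simp add: field_simps)
    moreover have "1 / y = real k / real n" by (simp add: y_def)
    ultimately show ?thesis by simp
  qed
  have count: "ln (real (card \<C>)) \<le> 896 * real n * ln (real n)"
  proof -
    \<comment> \<open>The empty family needs a container too, so the logarithm is
      meaningful.\<close>
    have ne: "0 < card \<C>" using \<C>(1,4) by (auto simp: card_gt_0_iff independent_in_def)
    define e where "e = 1 + (n choose k) div h"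
    have "(n choose k) + 1 \<le> n ^ k + n ^ k"
      using binomial_le_pow[OF kn] n by (intro add_mono) auto
    also have "\<dots> = 2 * n ^ k" by simp
    also have "\<dots> \<le> n * n ^ k" using n by (intro mult_right_mono) auto
    also have "\<dots> = n ^ (k + 1)" by simp
    finally have "((n choose k) + 1) ^ e \<le> (n ^ (k + 1)) ^ e" by (intro power_mono) auto
    moreover have "card \<C> \<le> ((n choose k) + 1) ^ e" using \<C>(2) by (simp add: card_kneser_verts e_def)
    ultimately have "card \<C> \<le> (n ^ (k + 1)) ^ e" by (rule order_trans[rotated])
    then have "card \<C> \<le> n ^ ((k + 1) * e)" by (simp only: power_mult)
    then have "real (card \<C>) \<le> real n ^ ((k + 1) * e)" by (metis of_nat_le_iff of_nat_power)
    then have "ln (real (card \<C>)) \<le> ln (real n ^ ((k + 1) * e))"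
      using ne n by (subst ln_le_cancel_iff) auto
    also have "\<dots> = real (k + 1) * real e * ln (real n)" using n by (simp add: ln_realpow algebra_simps)
    also have "\<dots> \<le> (2 * real k * (448 * y)) * ln (real n)"
    proof (intro mult_right_mono mult_mono)
      have "real ((n choose k) div h) \<le> v / real h" unfolding v_def by (rule of_nat_div_le_of_nat)
      then show "real e \<le> 448 * y" using vh r_le y by (simp add: e_def)
    qed (use k n in auto)
    also have "2 * real k * (448 * y) = 896 * real n" using k by (simp add: y_def)
    finally show ?thesis .
  qed
  show ?thesis
    using \<C>(1,3,4) count size
    by (intro exI[of _ \<C>] conjI ballI) (auto simp: card_kneser_verts v_def intro: order_trans)
qed

text \<open>Choosability would give \<open>v / 10 * (12/25) powr d0 <= 2 * l * ln (card \<C>) <= 224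
  * (n * ln n)^2\<close>. The bound on \<open>l\<close> makes the left side at least
  \<open>n powr (9/4) / (10 * 6 ^ 6)\<close>, contradicting the growth assumption.\<close>

lemma kneser_not_choosable:
  assumes k: "3 \<le> k" "k ^ 2 \<le> n" and n: "100000000 \<le> n"
    and growth: "224 * (real n * ln (real n))\<^sup>2 < real n powr (9/4) / (10 * 6 ^ 6)"
    and l: "0 < l" "real l \<le> (1/4 - 1 / (2 * real k)) * (real n * ln (real n) / 2)"
  shows "\<not> choosable (kneser_verts n k) kneser_adj l"
proof
  assume ch: "choosable (kneser_verts n k) kneser_adj l"
  define v where "v = real (n choose k)"
  define L where "L = real n * ln (real n)"
  obtain \<C> where \<C>: "finite \<C>" "ln (real (card \<C>)) \<le> 896 * real n * ln (real n)"
      "\<forall>C\<in>\<C>. C \<subseteq> kneser_verts n k \<and>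
         real (card C) \<le> 6/5 * (real k / real n) * real (n choose k)"
      "\<forall>F\<subseteq>kneser_verts n k. independent_in kneser_adj F \<longrightarrow> (\<exists>C\<in>\<C>. F \<subseteq> C)"
    using kneser_exists_containers[OF k n] by (elim exE conjE) (rule that)
  have n0: "0 < real n" and ln0: "0 \<le> ln (real n)" using n by auto
  \<comment> \<open>The \<open>8/3\<close> makes the incidence bound
    \<open>2 * l * 6/5 * (k/n) * v\<close> equal to \<open>9/10 * d0 * v\<close>.\<close>
  define d0 where "d0 = 8/3 * real l * (real k / real n)"
  have d0: "0 < d0" using l k n0 by (simp add: d0_def)
  have d0l: "13 * d0 \<le> real l"
  proof -
    have "35 * k \<le> n"
    proof (cases "35 \<le> k")
      case True
      then have "35 * k \<le> k ^ 2" by (simp add: power2_eq_square)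
      then show ?thesis using k by linarith
    qed (use n in auto)
    then have "35 * (real k / real n) \<le> 1" using n0 by (simp add: field_simps)
    then have *: "real l * (35 * (real k / real n)) \<le> real l * 1" by (intro mult_left_mono) auto
    have "13 * d0 = 104/105 * (real l * (35 * (real k / real n)))" by (simp add: d0_def)
    also have "\<dots> \<le> 1 * (real l * 1)" by (rule mult_mono[OF _ *]) auto
    finally show ?thesis by simp
  qed
  have "1 \<le> real (card \<C>) ^ (2 * l) * exp (- (real (card (kneser_verts n k)) / 10) * (12/25) powr d0)"
  proof (rule choosable_imp_many_containers[OF finite_kneser_verts \<C>(1) ch _ _ d0 d0l])
    show "\<exists>C\<in>\<C>. F \<subseteq> C" if "F \<subseteq> kneser_verts n k" "independent_in kneser_adj F" for F
      using \<C>(4) that by simp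
    show "C \<subseteq> kneser_verts n k \<and> real (card C) \<le> 6/5 * (real k / real n) * real (n choose k)"
      if "C \<in> \<C>" for C using \<C>(3) that by simp
    show "2 * real l * (6/5 * (real k / real n) * real (n choose k))
       \<le> 9/10 * d0 * real (card (kneser_verts n k))"
      by (simp add: d0_def card_kneser_verts mult_ac)
  qed
  then have one: "1 \<le> real (card \<C>) ^ (2 * l) * exp (- (v / 10) * (12/25) powr d0)"
    by (simp add: card_kneser_verts v_def)
  have "0 < card \<C>" using one l by (intro gr0I) (auto simp: power_0_left)
  then have "0 \<le> ln (real (card \<C>) ^ (2 * l) * exp (- (v / 10) * (12/25) powr d0))"
    using one by simp
  also have "\<dots> = 2 * real l * ln (real (card \<C>)) - v / 10 * (12/25) powr d0"
    using \<open>0 < card \<C>\<close> by (simp add: ln_mult ln_realpow)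
  finally have upper: "v / 10 * (12/25) powr d0 \<le> 2 * real l * ln (real (card \<C>))" by simp
  have "2 * real l * ln (real (card \<C>)) \<le> 2 * real l * (896 * L)"
    using \<C>(2) by (intro mult_left_mono) (auto simp: L_def mult_ac)
  also have "\<dots> \<le> (1/4 * L) * (896 * L)"
  proof (rule mult_right_mono)
    have "(1/4 - 1 / (2 * real k)) * (L / 2) \<le> 1/4 * (L / 2)"
      using n0 ln0 by (intro mult_right_mono) (auto simp: L_def)
    then have "real l \<le> 1/4 * (L / 2)" by (rule order_trans[OF l(2)[folded L_def]])
    then show "2 * real l \<le> 1/4 * L" by simp
  qed (use n0 ln0 in \<open>simp add: L_def\<close>)
  also have "\<dots> = 224 * L\<^sup>2" by (simp add: power2_eq_square)
  also have "\<dots> < real n powr (9/4) / 6 ^ 6 / 10" using growth by (simp add: L_def)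
  also have "\<dots> \<le> v * real n powr (1/2 - real k / 4) / 10"
    unfolding v_def by (intro divide_right_mono binomial_powr_lower k) auto
  also have "\<dots> \<le> v * (12/25) powr d0 / 10"
  proof (intro divide_right_mono mult_left_mono)
    \<comment> \<open>The left side is \<open>3/4 * d0\<close>, and the factor
      \<open>1/4 - 1/(2*k)\<close> becomes the exponent \<open>k/4 - 1/2\<close> of
      \<open>n\<close>.\<close>
    have "2 * real k / real n * real l \<le>
        2 * real k / real n * ((1/4 - 1 / (2 * real k)) * (real n * ln (real n) / 2))"
      using l(2) by (intro mult_left_mono) auto
    also have "\<dots> = (real k / 4 - 1/2) * ln (real n)" using n0 k by (simp add: field_simps)
    finally have "(1/2 - real k / 4) * ln (real n) \<le> - (3/4) * d0" by (simp add: d0_def field_simps)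
    then have "real n powr (1/2 - real k / 4) \<le> exp (- (3/4) * d0)" using n0 by (simp add: powr_def)
    also have "\<dots> \<le> (12/25) powr d0" using d0 by (intro powr_12_25_ge_exp) simp
    finally show "real n powr (1/2 - real k / 4) \<le> (12/25) powr d0" .
  qed (auto simp: v_def)
  finally show False using upper by simp
qed

text \<open>Take \<open>l\<close> as the floor of the bound, which is at least 1 because
  \<open>k >= 3\<close> makes the factor at least \<open>1/12\<close>. Choosability is monotone in
  the list size, so failure at \<open>l\<close> forces the choice number to be at least
  \<open>l + 1\<close>.\<close>

lemma kneser_choice_number_gt:
  "\<exists>n0. \<forall>n\<ge>n0. \<forall>k. 3 \<le> k \<and> k ^ 2 \<le> n \<longrightarrow>
     (1/4 - 1 / (2 * real k)) * (real n * ln (real n) / 2) < real (choice_number (kneser_verts n k) kneser_adj)"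
proof -
  have "eventually (\<lambda>n::nat. 224 * (real n * ln (real n))\<^sup>2 < real n powr (9/4) / (10 * 6 ^ 6)) at_top"
    by real_asymp
  moreover have "eventually (\<lambda>n::nat. 24 \<le> real n * ln (real n)) at_top" by real_asymp
  ultimately have "eventually (\<lambda>n::nat. 100000000 \<le> n \<and> 224 * (real n * ln (real n))\<^sup>2 < real n powr (9/4) / (10 * 6 ^ 6)
     \<and> 24 \<le> real n * ln (real n)) at_top"
    using eventually_ge_at_top[of "100000000 :: nat"] by eventually_elim blast
  then obtain n0 where n0: "\<And>n. n \<ge> n0 \<Longrightarrow> 100000000 \<le> n \<and>
      224 * (real n * ln (real n))\<^sup>2 < real n powr (9/4) / (10 * 6 ^ 6) \<and> 24 \<le> real n * ln (real n)"
    unfolding eventually_at_top_linorder by blast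
  show ?thesis
  proof (intro exI allI impI)
    fix n k :: nat
    assume nk: "n \<ge> n0" "3 \<le> k \<and> k ^ 2 \<le> n"
    note n = n0[OF nk(1)]
    define M where "M = (1/4 - 1 / (2 * real k)) * (real n * ln (real n) / 2)"
    define l where "l = nat \<lfloor>M\<rfloor>"
    have "1 / (2 * real k) \<le> 1/6" using nk by (intro divide_left_mono[of _ _ 1, simplified]) (auto simp: field_simps)
    then have "(1/12) * (24 / 2) \<le> M" unfolding M_def using n by (intro mult_mono) auto
    then have l: "0 < l" "real l \<le> M" "M < real l + 1" unfolding l_def by linarith+
    have "\<not> choosable (kneser_verts n k) kneser_adj l"
      by (rule kneser_not_choosable) (use nk n l in \<open>auto simp: M_def\<close>)
    moreover have "choosable (kneser_verts n k) kneser_adj (choice_number (kneser_verts n k) kneser_adj)"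
      by (rule choosable_choice_number) (auto simp: finite_kneser_verts kneser_adj_def)
    ultimately have "\<not> choice_number (kneser_verts n k) kneser_adj \<le> l"
      unfolding choosable_def using order_trans by blast
    then show "M < real (choice_number (kneser_verts n k) kneser_adj)" using l by linarith
  qed
qed

theorem theorem4:
  fixes \<epsilon> :: real
  assumes "\<epsilon> > 0"
  shows "\<exists>n0::nat. \<forall>n\<ge>n0. \<forall>k::nat.
           3 \<le> k \<and> real k \<le> (real n / (1 + \<epsilon>)) powr (1/2) \<longrightarrow>
           real (choice_number (kneser_verts n k) kneser_adj)
             > (1/4 - 1 / (2 * real k) - \<epsilon>) * (real n * ln (real n) / 2)"
proof -
  obtain n0 where n0: "\<forall>n\<ge>n0. \<forall>k. 3 \<le> k \<and> k ^ 2 \<le> n \<longrightarrow>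
     (1/4 - 1 / (2 * real k)) * (real n * ln (real n) / 2) < real (choice_number (kneser_verts n k) kneser_adj)"
    using kneser_choice_number_gt by blast
  show ?thesis
  proof (intro exI allI impI)
    fix n k :: nat
    assume n: "n \<ge> n0" and k: "3 \<le> k \<and> real k \<le> (real n / (1 + \<epsilon>)) powr (1/2)"
    have "real k ^ 2 \<le> sqrt (real n / (1 + \<epsilon>)) ^ 2"
      using k assms by (intro power_mono) (auto simp: powr_half_sqrt)
    also have "\<dots> = real n / (1 + \<epsilon>)" using assms by simp
    also have "\<dots> \<le> real n / 1" using assms by (intro divide_left_mono) auto
    finally have k2: "k ^ 2 \<le> n" by (simp flip: of_nat_power)
    \<comment> \<open>From \<open>n >= 1\<close> follows \<open>n * ln n >= 0\<close>, so
      subtracting \<epsilon> only lowers the bound.\<close>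
    then have "0 < n" using k by (intro gr0I) auto
    then have "(1/4 - 1 / (2 * real k) - \<epsilon>) * (real n * ln (real n) / 2) \<le>
        (1/4 - 1 / (2 * real k)) * (real n * ln (real n) / 2)"
      using assms by (intro mult_right_mono) auto
    also have "\<dots> < real (choice_number (kneser_verts n k) kneser_adj)" using n0 n k k2 by blast
    finally show "(1/4 - 1 / (2 * real k) - \<epsilon>) * (real n * ln (real n) / 2)
      < real (choice_number (kneser_verts n k) kneser_adj)" .
  qed
qed

end
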